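(* Let $\overline{\mathrm{Lip}}^{\mathsf{s}}$, $\mathrm{BV}$ and $\overline{\mathrm{Lip}}^{\mathsf{w}}$ denote, respectively, the class of functions $f:[0,1]\to\mathbb{R}$ with finite strong average smoothness $\|f\|_{\mathrm{S}}<\infty$, the class of functions $f:[0,1]\to\mathbb{R}$ with finite variation $V(f)<\infty$, and the class of functions $f:[0,1]\to\mathbb{R}$ with finite weak average smoothness $\|f\|_{\mathrm{W}}<\infty$. Then $$\overline{\mathrm{Lip}}^{\mathsf{s}}\subsetneq \mathrm{BV}\subsetneq \overline{\mathrm{Lip}}^{\mathsf{w}},$$ where both containments are strict.
   Context: For $f:[0,1]\to\mathbb{R}$ and $x\in[0,1]$, the local slope of $f$ at $x$ is $$\Lambda_f(x)=\sup_{x'\in[0,1]\setminus\{x\}}\frac{|f(x)-f(x')|}{|x-x'|}\in[0,\infty].$$ Let $U$ be the uniform distribution (Lebesgue measure) on $[0,1]$ and let $X$ be a random variable distributed according to $U$. The strong average smoothness of $f$ is $\|f\|_{\mathrm{S}}=\mathbb{E}[\Lambda_f(X)]\in[0,\infty]$. The weak average smoothness of $f$ is $\|f\|_{\mathrm{W}}=\sup_{t>0}\,t\,U(\{x\in[0,1]:\Lambda_f(x)\ge t\})\in[0,\infty]$. The variation of $f$ on $[0,1]$ is $$V(f)=\sup_{0=x_0<x_1<\dots<x_n\le 1}\ \sum_{i=1}^n|f(x_i)-f(x_{i-1})|\in[0,\infty],$$ the supremum being over all $n$ and all such finite sequences. *)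

theory Defs
  imports "HOL-Analysis.Analysis"
begin

definition local_slope :: "(real \<Rightarrow> real) \<Rightarrow> real \<Rightarrow> ennreal" where
  "local_slope f x = (SUP x' \<in> {0..1} - {x}. ennreal (\<bar>f x - f x'\<bar> / \<bar>x - x'\<bar>))"

abbreviation uniform01 :: "real measure" where
  "uniform01 \<equiv> lebesgue_on {0..1}"

text \<open>For every \<open>f\<close>, measurable or not, the sublevel sets \<open>{x \<in> {0..1}. local_slope f x \<le> t}\<close>
  with \<open>t < \<infinity>\<close> are closed, so \<open>local_slope f\<close> is Borel measurable on the unit interval and
  the next two definitions need no measurability side condition. The expectation of
  the slope at a \<open>uniform01\<close>-distributed random variable is written as the integral against its law.\<close>

definition strong_smoothness :: "(real \<Rightarrow> real) \<Rightarrow> ennreal" where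
  "strong_smoothness f = (\<integral>\<^sup>+ x. local_slope f x \<partial>uniform01)"

definition weak_smoothness :: "(real \<Rightarrow> real) \<Rightarrow> ennreal" where
  "weak_smoothness f =
     (SUP t \<in> {0<..}. ennreal t * emeasure uniform01 {x \<in> {0..1}. local_slope f x \<ge> ennreal t})"

text \<open>A partition with \<open>n + 1\<close> points is encoded by the values of \<open>x\<close> on \<open>{0..n}\<close>; the other
  values of \<open>x\<close> are unconstrained and irrelevant.\<close>

definition variation :: "(real \<Rightarrow> real) \<Rightarrow> ennreal" where
  "variation f =
     (SUP (n, x) \<in> {(n :: nat, x :: nat \<Rightarrow> real).
                      x 0 = 0 \<and> (\<forall>i \<in> {1..n}. x (i - 1) < x i) \<and> x n \<le> 1}.
        ennreal (\<Sum>i = 1..n. \<bar>f (x i) - f (x (i - 1))\<bar>))"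

text \<open>Functions on the unit interval are elements of the extensional function space,
  so that distinct elements of the classes below differ somewhere on \<open>{0..1}\<close>.\<close>

definition Lip_strong :: "(real \<Rightarrow> real) set" where
  "Lip_strong = {f \<in> {0..1} \<rightarrow>\<^sub>E UNIV. strong_smoothness f < \<infinity>}"

definition BV :: "(real \<Rightarrow> real) set" where
  "BV = {f \<in> {0..1} \<rightarrow>\<^sub>E UNIV. variation f < \<infinity>}"

definition Lip_weak :: "(real \<Rightarrow> real) set" where
  "Lip_weak = {f \<in> {0..1} \<rightarrow>\<^sub>E UNIV. weak_smoothness f < \<infinity>}"

end

theory Submission
  imports Defs
begin

text \<open>Both inclusions come from quantitative inequalities.

  The first is \<open>variation f \<le> strong_smoothness f\<close>. A chord of the graph over \<open>[a, b]\<close> can be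
  broken at any interior point \<open>x\<close>, and one of the two pieces is at least as steep as the whole;
  so the local slope is at least \<open>\<bar>f b - f a\<bar> / (b - a)\<close> throughout \<open>(a, b)\<close>, and its integral over
  \<open>(a, b)\<close> is at least \<open>\<bar>f b - f a\<bar>\<close>. Summing over the gaps of a partition gives the claim.

  The second is \<open>weak_smoothness f \<le> 10 * variation f\<close>, an inequality of Hardy-Littlewood maximal
  type. Each point of local slope at least \<open>t\<close> is an endpoint of a chord of slope above \<open>t / 2\<close>.
  By Vitali's covering lemma, disjoint ones among the base intervals of these chords, enlarged
  five times, cover all such points. The total length of disjoint steep intervals is at most
  \<open>2 / t\<close> times the increments of \<open>f\<close> over them, and these increments add up to at most the
  variation of \<open>f\<close>. The last fact is obtained through a monotone function that dominates the
  increments of \<open>f\<close>, namely the variation on \<open>[0, x]\<close> as a function of \<open>x\<close>.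

  Two functions show that the inclusions are strict. The indicator of the point 0 has variation 1,
  but its local slope at \<open>x > 0\<close> is at least \<open>1 / x\<close>, which is not integrable. The function
  \<open>cos (ln x)\<close> is bounded and has derivative at most \<open>1 / x\<close> in absolute value, so its local slope
  is at most \<open>4 / x\<close>, which lies in weak \<open>L\<^sup>1\<close>; yet it oscillates between 1 and -1 infinitely
  often near 0.\<close>

section \<open>Partitions of the unit interval\<close>

lemma partition_mono:
  fixes p :: "nat \<Rightarrow> real"
  assumes "\<forall>i\<in>{1..n}. p (i - 1) < p i" and "i \<le> j" and "j \<le> n"
  shows "p i \<le> p j"
  using assms(2,3)
proof (induction j rule: dec_induct)
  case base
  show ?case by simp
next
  case (step j)
  have "p (Suc j - 1) < p (Suc j)"
    using assms(1) step.prems by (intro bspec[OF assms(1)]) auto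
  with step show ?case by simp
qed

lemma partition_sum_le_variation:
  fixes p :: "nat \<Rightarrow> real"
  assumes "p 0 = 0" "\<forall>i\<in>{1..n}. p (i - 1) < p i" "p n \<le> 1"
  shows "ennreal (\<Sum>i = 1..n. \<bar>f (p i) - f (p (i - 1))\<bar>) \<le> variation f"
  unfolding variation_def using assms by (intro SUP_upper2[where i = "(n, p)"]) auto

lemma variation_le:
  assumes "\<And>(n :: nat) (p :: nat \<Rightarrow> real). p 0 = 0 \<Longrightarrow> \<forall>i\<in>{1..n}. p (i - 1) < p i \<Longrightarrow> p n \<le> 1 \<Longrightarrow>
             ennreal (\<Sum>i = 1..n. \<bar>f (p i) - f (p (i - 1))\<bar>) \<le> B"
  shows "variation f \<le> B"
  unfolding variation_def by (rule SUP_least) (use assms in auto)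

lemma slope_le_local_slope:
  assumes "y \<in> {0..1}" "y \<noteq> x"
  shows "ennreal (\<bar>f x - f y\<bar> / \<bar>x - y\<bar>) \<le> local_slope f x"
  unfolding local_slope_def by (rule SUP_upper) (use assms in auto)

section \<open>Strong average smoothness dominates variation\<close>

text \<open>The increment over \<open>[a, b]\<close> is the sum of those over \<open>[a, x]\<close> and \<open>[x, b]\<close>. If both of these
  had slope below that of the chord, then so would the sum.\<close>

lemma chord_slope_le_local_slope:
  assumes "0 \<le> a" "a < x" "x < b" "b \<le> 1"
  shows "ennreal (\<bar>f b - f a\<bar> / (b - a)) \<le> local_slope f x"
proof -
  define s where "s = \<bar>f b - f a\<bar> / (b - a)"
  have "s \<le> \<bar>f x - f a\<bar> / \<bar>x - a\<bar> \<or> s \<le> \<bar>f x - f b\<bar> / \<bar>x - b\<bar>"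
  proof (rule ccontr)
    assume "\<not> ?thesis"
    then have "\<bar>f x - f a\<bar> < s * (x - a)" "\<bar>f x - f b\<bar> < s * (b - x)"
      using assms by (auto simp: not_le pos_divide_less_eq)
    then have "\<bar>f b - f a\<bar> < s * (x - a) + s * (b - x)"
      by linarith
    also have "\<dots> = s * (b - a)"
      by (simp add: algebra_simps)
    also have "\<dots> = \<bar>f b - f a\<bar>"
      using assms by (simp add: s_def)
    finally show False by simp
  qed
  then show ?thesis
    using slope_le_local_slope[of a x f] slope_le_local_slope[of b x f] assms
    unfolding s_def by (auto intro: order_trans[OF ennreal_leI])
qed

text \<open>The step function equal to the chord slope on each open gap of a partition has as integral
  the variation sum of that partition, and it lies below the local slope.\<close>

lemma variation_le_strong_smoothness: "variation f \<le> strong_smoothness f"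
proof (rule variation_le)
  fix n :: nat and p :: "nat \<Rightarrow> real"
  assume p0: "p 0 = 0" and inc: "\<forall>i\<in>{1..n}. p (i - 1) < p i" and pn: "p n \<le> 1"
  define A where "A i = {p (i - 1)<..<p i}" for i
  define s where "s i = \<bar>f (p i) - f (p (i - 1))\<bar> / (p i - p (i - 1))" for i
  have step: "p (i - 1) < p i" "0 \<le> p (i - 1)" "p i \<le> 1" if "i \<in> {1..n}" for i
    using inc that partition_mono[OF inc, of 0 "i - 1"] partition_mono[OF inc, of i n] p0 pn
    by auto
  have same: "i = j" if "i \<in> {1..n}" "j \<in> {1..n}" "x \<in> A i" "x \<in> A j" for i j x
  proof (rule ccontr)
    assume "i \<noteq> j"
    then consider "i \<le> j - 1" | "j \<le> i - 1" by linarith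
    moreover have "i - 1 \<le> n" "j - 1 \<le> n"
      using that by auto
    ultimately show False
      using partition_mono[OF inc, of i "j - 1"] partition_mono[OF inc, of j "i - 1"] that
      by cases (auto simp: A_def)
  qed
  have "ennreal (\<Sum>i = 1..n. \<bar>f (p i) - f (p (i - 1))\<bar>)
      = (\<Sum>i = 1..n. ennreal \<bar>f (p i) - f (p (i - 1))\<bar>)"
    by (simp add: sum_ennreal)
  also have "\<dots> = (\<Sum>i = 1..n. ennreal (s i) * emeasure uniform01 (A i))"
  proof (rule sum.cong[OF refl])
    fix i assume i: "i \<in> {1..n}"
    have "emeasure uniform01 (A i) = emeasure lebesgue (A i)"
      by (rule emeasure_restrict_space) (use step[OF i] in \<open>auto simp: A_def\<close>)
    also have "\<dots> = ennreal (p i - p (i - 1))"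
      using step[OF i] by (simp add: A_def)
    finally show "ennreal \<bar>f (p i) - f (p (i - 1))\<bar> = ennreal (s i) * emeasure uniform01 (A i)"
      using step[OF i] by (simp add: s_def flip: ennreal_mult')
  qed
  also have "\<dots> = (\<Sum>i = 1..n. \<integral>\<^sup>+ x. ennreal (s i) * indicator (A i) x \<partial>uniform01)"
  proof (rule sum.cong[OF refl])
    fix i assume i: "i \<in> {1..n}"
    have "A i \<in> sets uniform01"
      using step[OF i] by (auto simp: A_def sets_restrict_space_iff)
    then show "ennreal (s i) * emeasure uniform01 (A i)
        = (\<integral>\<^sup>+ x. ennreal (s i) * indicator (A i) x \<partial>uniform01)"
      by (simp add: nn_integral_cmult_indicator)
  qed
  also have "\<dots> = (\<integral>\<^sup>+ x. (\<Sum>i = 1..n. ennreal (s i) * indicator (A i) x) \<partial>uniform01)"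
  proof (rule nn_integral_sum[symmetric])
    fix i assume i: "i \<in> {1..n}"
    have "A i \<in> sets uniform01"
      using step[OF i] by (auto simp: A_def sets_restrict_space_iff)
    then show "(\<lambda>x. ennreal (s i) * indicator (A i) x) \<in> borel_measurable uniform01"
      by simp
  qed
  also have "\<dots> \<le> (\<integral>\<^sup>+ x. local_slope f x \<partial>uniform01)"
  proof (rule nn_integral_mono)
    fix x
    show "(\<Sum>i = 1..n. ennreal (s i) * indicator (A i) x) \<le> local_slope f x"
    proof (cases "\<exists>i\<in>{1..n}. x \<in> A i")
      case True
      then obtain i where i: "i \<in> {1..n}" "x \<in> A i" by blast
      have "(\<Sum>j = 1..n. ennreal (s j) * indicator (A j) x)
          = (\<Sum>j = 1..n. if j = i then ennreal (s j) else 0)"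
        using i same by (intro sum.cong) (auto simp: indicator_def)
      also have "\<dots> = ennreal (s i)"
        using i by simp
      also have "\<dots> \<le> local_slope f x"
        using i step[of i] unfolding s_def by (intro chord_slope_le_local_slope) (auto simp: A_def)
      finally show ?thesis .
    next
      case False
      then have "(\<Sum>i = 1..n. ennreal (s i) * indicator (A i) x) = 0"
        by (auto intro!: sum.neutral)
      then show ?thesis by simp
    qed
  qed
  finally show "ennreal (\<Sum>i = 1..n. \<bar>f (p i) - f (p (i - 1))\<bar>) \<le> strong_smoothness f"
    by (simp add: strong_smoothness_def)
qed

section \<open>Variation dominates weak average smoothness\<close>

text \<open>A monotone function takes disjoint intervals to intervals \<open>(v (l i), v (u i))\<close> that are again
  disjoint and lie in \<open>[v a, v b]\<close>; comparing Lebesgue measures in the range gives the bound without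
  sorting the intervals.\<close>

lemma sum_increments_disjoint_intervals_le:
  fixes v :: "real \<Rightarrow> real" and l u :: "'i \<Rightarrow> real"
  assumes "mono_on {a..b} v" "a \<le> b" "finite I"
    and lu: "\<And>i. i \<in> I \<Longrightarrow> a \<le> l i \<and> l i \<le> u i \<and> u i \<le> b"
    and disj: "pairwise (\<lambda>i j. disjnt {l i..u i} {l j..u j}) I"
  shows "(\<Sum>i\<in>I. v (u i) - v (l i)) \<le> v b - v a"
proof -
  have mono: "v x \<le> v y" if "a \<le> x" "x \<le> y" "y \<le> b" for x y
    using assms(1) that by (auto simp: mono_on_def)
  have vdisj: "disjoint_family_on (\<lambda>i. {v (l i)<..<v (u i)}) I"
    unfolding disjoint_family_on_def
  proof (intro ballI impI)
    fix i j assume ij: "i \<in> I" "j \<in> I" "i \<noteq> j"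
    have "disjnt {l i..u i} {l j..u j}"
      using disj ij by (auto simp: pairwise_def)
    then have "max (l i) (l j) \<notin> {l i..u i} \<inter> {l j..u j}"
      by (simp add: disjnt_def)
    then have "u i \<le> l j \<or> u j \<le> l i"
      using lu[of i] lu[of j] ij by auto
    then show "{v (l i)<..<v (u i)} \<inter> {v (l j)<..<v (u j)} = {}"
      using mono[of "u i" "l j"] mono[of "u j" "l i"] lu[of i] lu[of j] ij by fastforce
  qed
  have "(\<Sum>i\<in>I. v (u i) - v (l i)) = (\<Sum>i\<in>I. measure lborel {v (l i)<..<v (u i)})"
    using lu mono by (intro sum.cong) auto
  also have "\<dots> = measure lborel (\<Union>i\<in>I. {v (l i)<..<v (u i)})"
    using assms(3) vdisj lu mono by (intro measure_finite_Union[symmetric]) auto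
  also have "\<dots> \<le> measure lborel {v a..v b}"
  proof (rule measure_mono_fmeasurable)
    show "(\<Union>i\<in>I. {v (l i)<..<v (u i)}) \<subseteq> {v a..v b}"
      using mono[of a "l _"] mono[of "u _" b] lu by force
    show "(\<Union>i\<in>I. {v (l i)<..<v (u i)}) \<in> sets lborel"
      using assms(3) by (intro sets.finite_UN) auto
    show "{v a..v b} \<in> fmeasurable lborel"
      by (rule fmeasurableI) (auto simp: emeasure_lborel_Icc_eq)
  qed
  also have "\<dots> = v b - v a"
    using mono assms(2) by simp
  finally show ?thesis .
qed

text \<open>The Vitali covering argument. The constant 10 is the product of the factor 5 in the covering
  lemma and the factor 2 lost in choosing, at a point of local slope at least \<open>t\<close>, a chord of slope
  above \<open>t / 2\<close>: the supremum that defines the local slope need not be attained.\<close>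

lemma weak_smoothness_le_of_dominated_increments:
  fixes f v :: "real \<Rightarrow> real"
  assumes dom: "\<And>a b. 0 \<le> a \<Longrightarrow> a \<le> b \<Longrightarrow> b \<le> 1 \<Longrightarrow> \<bar>f b - f a\<bar> \<le> v b - v a"
  shows "weak_smoothness f \<le> ennreal (10 * (v 1 - v 0))"
  unfolding weak_smoothness_def
proof (rule SUP_least)
  fix t :: real assume "t \<in> {0<..}"
  then have t: "t > 0" by simp
  define E where "E = {x \<in> {0..1}. local_slope f x \<ge> ennreal t}"
  have mono: "mono_on {0..1} v"
    using dom by (force simp: mono_on_def)
  have D: "0 \<le> v 1 - v 0"
    using dom[of 0 1] by auto
  have "\<exists>y\<in>{0..1} - {x}. t / 2 < \<bar>f x - f y\<bar> / \<bar>x - y\<bar>" if "x \<in> E" for x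
  proof -
    have "ennreal (t / 2) < ennreal t"
      using t by (simp add: ennreal_less_iff)
    also have "ennreal t \<le> local_slope f x"
      using that by (simp add: E_def)
    finally show ?thesis
      using t by (auto simp: local_slope_def less_SUP_iff ennreal_less_iff)
  qed
  then obtain y where y: "\<And>x. x \<in> E \<Longrightarrow> y x \<in> {0..1} - {x}"
      "\<And>x. x \<in> E \<Longrightarrow> t / 2 < \<bar>f x - f (y x)\<bar> / \<bar>x - y x\<bar>"
    by metis
  define l where "l x = min x (y x)" for x
  define u where "u x = max x (y x)" for x
  define m where "m x = (l x + u x) / 2" for x
  define r where "r x = (u x - l x) / 2" for x
  have lu: "0 \<le> l x \<and> l x < u x \<and> u x \<le> 1" if "x \<in> E" for x
    using y(1)[OF that] that by (auto simp: l_def u_def E_def)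
  have steep: "u x - l x \<le> 2 / t * (v (u x) - v (l x))" if "x \<in> E" for x
  proof -
    have "t / 2 < \<bar>f (u x) - f (l x)\<bar> / (u x - l x)"
      using y[OF that] by (cases "x \<le> y x") (auto simp: l_def u_def abs_minus_commute)
    also have "\<dots> \<le> (v (u x) - v (l x)) / (u x - l x)"
      using lu[OF that] by (intro divide_right_mono dom) auto
    finally show ?thesis
      using lu[OF that] t by (simp add: field_simps)
  qed
  \<comment> \<open>Vitali's lemma speaks of balls, so each interval is presented by midpoint and radius.\<close>
  have cball: "cball (m x) (r x) = {l x..u x}" for x
    by (auto simp: cball_eq_atLeastAtMost m_def r_def field_simps)
  have cover: "E \<subseteq> (\<Union>x\<in>E. cball (m x) (r x))"
    unfolding cball by (auto simp: l_def u_def)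
  obtain C where C: "countable C" "C \<subseteq> E"
      "pairwise (\<lambda>i j. disjnt (cball (m i) (r i)) (cball (m j) (r j))) C"
      "E \<subseteq> (\<Union>x\<in>C. cball (m x) (5 * r x))"
  proof (rule Vitali_covering_lemma_cballs[OF cover])
    show "0 < r x \<and> r x \<le> 1" if "x \<in> E" for x
      using lu[OF that] by (simp add: r_def)
  qed
  have bound: "measure lebesgue (\<Union>x\<in>I. cball (m x) (5 * r x)) \<le> 10 / t * (v 1 - v 0)"
    if I: "I \<subseteq> C" "finite I" for I
  proof -
    have IE: "x \<in> E" if "x \<in> I" for x
      using that I C by blast
    have "measure lebesgue (\<Union>x\<in>I. cball (m x) (5 * r x))
        \<le> (\<Sum>x\<in>I. measure lebesgue (cball (m x) (5 * r x)))"
      using I by (intro measure_UNION_le) auto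
    also have "\<dots> = (\<Sum>x\<in>I. 5 * (u x - l x))"
    proof (rule sum.cong[OF refl])
      fix x assume "x \<in> I"
      then have "l x < u x"
        using lu IE by blast
      then show "measure lebesgue (cball (m x) (5 * r x)) = 5 * (u x - l x)"
        by (simp add: cball_eq_atLeastAtMost r_def field_simps)
    qed
    also have "\<dots> \<le> (\<Sum>x\<in>I. 10 / t * (v (u x) - v (l x)))"
    proof (rule sum_mono)
      fix x assume "x \<in> I"
      then have "5 * (u x - l x) \<le> 5 * (2 / t * (v (u x) - v (l x)))"
        using steep IE by (intro mult_left_mono) auto
      then show "5 * (u x - l x) \<le> 10 / t * (v (u x) - v (l x))"
        by simp
    qed
    also have "\<dots> = 10 / t * (\<Sum>x\<in>I. v (u x) - v (l x))"
      by (simp add: sum_distrib_left)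
    also have "\<dots> \<le> 10 / t * (v 1 - v 0)"
    proof (rule mult_left_mono[OF sum_increments_disjoint_intervals_le[OF mono _ I(2)]])
      show "pairwise (\<lambda>i j. disjnt {l i..u i} {l j..u j}) I"
        using C(3) I(1) unfolding cball by (rule pairwise_subset)
    qed (use lu IE t in \<open>auto simp: less_imp_le\<close>)
    finally show ?thesis .
  qed
  have meas: "cball (m x) (5 * r x) \<in> lmeasurable" for x
    by simp
  have "emeasure uniform01 E = emeasure lebesgue E"
    by (rule emeasure_restrict_space) (auto simp: E_def)
  also have "\<dots> \<le> emeasure lebesgue (\<Union>x\<in>C. cball (m x) (5 * r x))"
    using C by (intro emeasure_mono sets.countable_UN') auto
  also have "\<dots> = ennreal (measure lebesgue (\<Union>x\<in>C. cball (m x) (5 * r x)))"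
    by (rule emeasure_eq_measure2[OF fmeasurable_UN_bound[OF C(1) meas bound]])
  also have "\<dots> \<le> ennreal (10 / t * (v 1 - v 0))"
    by (intro ennreal_leI measure_UN_bound[OF C(1) meas bound])
  finally have "ennreal t * emeasure uniform01 E \<le> ennreal t * ennreal (10 / t * (v 1 - v 0))"
    by (rule mult_left_mono) simp
  also have "\<dots> = ennreal (10 * (v 1 - v 0))"
    using t D by (simp flip: ennreal_mult)
  finally show "ennreal t * emeasure uniform01 {x \<in> {0..1}. local_slope f x \<ge> ennreal t}
      \<le> ennreal (10 * (v 1 - v 0))"
    by (simp add: E_def)
qed

text \<open>Partitions are required to end exactly at \<open>x\<close>, so that a partition of \<open>[0, a]\<close> extends to one of
  \<open>[0, b]\<close> by appending the single point \<open>b\<close>.\<close>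

definition variation_sums :: "(real \<Rightarrow> real) \<Rightarrow> real \<Rightarrow> real set" where
  "variation_sums f x =
     {(\<Sum>i = 1..n. \<bar>f (p i) - f (p (i - 1))\<bar>) | (n :: nat) p.
        p 0 = 0 \<and> (\<forall>i\<in>{1..n}. p (i - 1) < p i) \<and> p n = x}"

lemma variation_sums_extend:
  fixes a b :: real
  assumes "s \<in> variation_sums f a" "a < b"
  shows "s + \<bar>f b - f a\<bar> \<in> variation_sums f b"
proof -
  obtain n :: nat and p where s: "s = (\<Sum>i = 1..n. \<bar>f (p i) - f (p (i - 1))\<bar>)"
    and p: "p 0 = 0" "\<forall>i\<in>{1..n}. p (i - 1) < p i" "p n = a"
    using assms(1) unfolding variation_sums_def by blast
  define q where "q = p(Suc n := b)"
  have "(\<Sum>i = 1..Suc n. \<bar>f (q i) - f (q (i - 1))\<bar>)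
      = (\<Sum>i = 1..n. \<bar>f (q i) - f (q (i - 1))\<bar>) + \<bar>f b - f a\<bar>"
    using p by (simp add: q_def)
  also have "(\<Sum>i = 1..n. \<bar>f (q i) - f (q (i - 1))\<bar>) = s"
    unfolding s by (intro sum.cong) (auto simp: q_def)
  finally have "s + \<bar>f b - f a\<bar> = (\<Sum>i = 1..Suc n. \<bar>f (q i) - f (q (i - 1))\<bar>)" ..
  moreover have "q 0 = 0" "\<forall>i\<in>{1..Suc n}. q (i - 1) < q i" "q (Suc n) = b"
    using p assms(2) by (auto simp: q_def le_Suc_eq)
  ultimately show ?thesis
    unfolding variation_sums_def by blast
qed

lemma variation_sums_nonempty:
  assumes "0 \<le> x"
  shows "variation_sums f x \<noteq> {}"
proof -
  have "0 \<in> variation_sums f 0"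
    unfolding variation_sums_def by (intro CollectI exI[of _ 0] exI[of _ "\<lambda>_. 0"]) auto
  then show ?thesis
    using variation_sums_extend[of 0 f 0 x] assms by (cases "x = 0") auto
qed

lemma variation_sums_bounds:
  assumes "variation f < \<infinity>" "x \<le> 1" "s \<in> variation_sums f x"
  shows "0 \<le> s" "s \<le> enn2real (variation f)"
proof -
  obtain n :: nat and p where s: "s = (\<Sum>i = 1..n. \<bar>f (p i) - f (p (i - 1))\<bar>)"
    and p: "p 0 = 0" "\<forall>i\<in>{1..n}. p (i - 1) < p i" "p n = x"
    using assms(3) unfolding variation_sums_def by blast
  show "0 \<le> s"
    unfolding s by (rule sum_nonneg) simp
  have "ennreal s \<le> variation f"
    unfolding s using p assms(2) by (intro partition_sum_le_variation) auto
  then show "s \<le> enn2real (variation f)"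
    using \<open>0 \<le> s\<close> assms(1) enn2real_mono by fastforce
qed

text \<open>The supremum of \<open>variation_sums f x\<close> is the variation of \<open>f\<close> on \<open>[0, x]\<close>; by
  \<open>variation_sums_extend\<close> its increments dominate those of \<open>f\<close>.\<close>

lemma weak_smoothness_le_variation:
  assumes fin: "variation f < \<infinity>"
  shows "weak_smoothness f \<le> 10 * variation f"
proof -
  define V where "V = enn2real (variation f)"
  define v where "v x = Sup (variation_sums f x)" for x
  have bdd: "bdd_above (variation_sums f x)" if "x \<le> 1" for x
    using variation_sums_bounds(2)[OF fin that] by (intro bdd_aboveI)
  have dom: "\<bar>f b - f a\<bar> \<le> v b - v a" if ab: "0 \<le> a" "a \<le> b" "b \<le> 1" for a b
  proof (cases "a = b")
    case False
    have "v a \<le> v b - \<bar>f b - f a\<bar>"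
      unfolding v_def
    proof (rule cSup_least)
      show "variation_sums f a \<noteq> {}"
        using ab by (intro variation_sums_nonempty)
      fix s assume "s \<in> variation_sums f a"
      then have "s + \<bar>f b - f a\<bar> \<in> variation_sums f b"
        using False ab by (intro variation_sums_extend) auto
      then show "s \<le> Sup (variation_sums f b) - \<bar>f b - f a\<bar>"
        using cSup_upper[OF _ bdd] ab by fastforce
    qed
    then show ?thesis by simp
  qed simp
  have "v 1 \<le> V"
    unfolding v_def V_def
    by (rule cSup_least) (use variation_sums_bounds[OF fin, of 1] variation_sums_nonempty in auto)
  moreover have "0 \<le> v 0"
  proof -
    obtain s where "s \<in> variation_sums f 0"
      using variation_sums_nonempty[of 0 f] by auto
    then show ?thesis
      unfolding v_def using variation_sums_bounds[OF fin, of 0 s] bdd[of 0]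
      by (auto intro: cSup_upper2)
  qed
  ultimately have "ennreal (10 * (v 1 - v 0)) \<le> ennreal (10 * V)"
    by (intro ennreal_leI) simp
  also have "\<dots> = 10 * variation f"
    using fin by (simp add: V_def ennreal_mult)
  finally show ?thesis
    using weak_smoothness_le_of_dominated_increments[of f v, OF dom] by (meson order_trans)
qed

section \<open>Strictness of the first containment\<close>

definition spike :: "real \<Rightarrow> real" where
  "spike = restrict (\<lambda>x. if x = 0 then 1 else 0) {0..1}"

text \<open>All partition points after the first are positive, so only the first gap contributes.\<close>

lemma variation_spike: "variation spike \<le> 1"
proof (rule variation_le)
  fix n :: nat and p :: "nat \<Rightarrow> real"
  assume p: "p 0 = 0" "\<forall>i\<in>{1..n}. p (i - 1) < p i" "p n \<le> 1"
  have val: "spike (p i) = (if i = 0 then 1 else 0)" if "i \<le> n" for i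
  proof (cases "i = 0")
    case False
    have "p (i - 1) < p i" "i - 1 \<le> n"
      using p(2) False that by auto
    then have "0 < p i" "p i \<le> 1"
      using that p partition_mono[OF p(2), of 0 "i - 1"] partition_mono[OF p(2), of i n]
      by auto
    then show ?thesis
      using False by (simp add: spike_def)
  qed (use p in \<open>simp add: spike_def\<close>)
  have "(\<Sum>i = 1..n. \<bar>spike (p i) - spike (p (i - 1))\<bar>) = (\<Sum>i = 1..n. if i = 1 then 1 else 0)"
    by (intro sum.cong) (auto simp: val)
  also have "\<dots> \<le> 1"
    by simp
  finally show "ennreal (\<Sum>i = 1..n. \<bar>spike (p i) - spike (p (i - 1))\<bar>) \<le> 1"
    by simp
qed

lemma strong_smoothness_spike: "strong_smoothness spike = \<infinity>"
proof (rule ccontr)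
  assume "strong_smoothness spike \<noteq> \<infinity>"
  then obtain B where B: "0 \<le> B" "strong_smoothness spike = ennreal B"
    by (cases "strong_smoothness spike") auto
  \<comment> \<open>The integral of \<open>1 / x\<close> over \<open>[c, 1]\<close> is \<open>- ln c\<close>, here one more than the supposed value.\<close>
  define c where "c = exp (- (B + 1))"
  have c: "0 < c" "c \<le> 1"
    using B by (auto simp: c_def)
  have "((\<lambda>x. 1 / x) has_integral (ln 1 - ln c)) {c..1}"
    using c by (intro fundamental_theorem_of_calculus)
      (auto intro!: derivative_eq_intros simp flip: has_real_derivative_iff_has_vector_derivative)
  then have "ennreal (ln 1 - ln c) = (\<integral>\<^sup>+ x. ennreal (1 / x) * indicator {c..1} x \<partial>lborel)"
    using c by (intro nn_integral_has_integral_lebesgue'[symmetric]) auto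
  also have "\<dots> = (\<integral>\<^sup>+ x. ennreal (1 / x) * indicator {c..1} x \<partial>lebesgue)"
    by (simp add: nn_integral_completion)
  also have "\<dots> \<le> (\<integral>\<^sup>+ x. local_slope spike x * indicator {0..1} x \<partial>lebesgue)"
  proof (rule nn_integral_mono)
    fix x :: real
    show "ennreal (1 / x) * indicator {c..1} x \<le> local_slope spike x * indicator {0..1} x"
      using slope_le_local_slope[of 0 x spike] c by (auto simp: spike_def split: split_indicator)
  qed
  also have "\<dots> = strong_smoothness spike"
    by (simp add: strong_smoothness_def nn_integral_restrict_space)
  finally show False
    using B by (simp add: c_def)
qed

section \<open>Strictness of the second containment\<close>

definition log_wave :: "real \<Rightarrow> real" where
  "log_wave = restrict (\<lambda>x. cos (ln x)) {0..1}"

lemma abs_cos_diff_le: "\<bar>cos a - cos b\<bar> \<le> \<bar>a - b\<bar>" for a b :: real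
proof -
  have "norm (cos a - cos b) \<le> 1 * norm (a - b)"
    by (rule field_differentiable_bound[of UNIV _ "\<lambda>x. - sin x"])
       (auto intro!: derivative_eq_intros)
  then show ?thesis by simp
qed

text \<open>Chords that end left of \<open>x / 2\<close> have base longer than \<open>x / 2\<close> and height at most 2. From
  \<open>x / 2\<close> on, chords of the logarithm have slope at most \<open>2 / x\<close>, and the cosine does not increase
  distances. The first case includes the endpoint 0, where the wave has the default value
  \<open>cos (ln 0)\<close>.\<close>

lemma local_slope_log_wave:
  assumes x: "0 < x" "x \<le> 1"
  shows "local_slope log_wave x \<le> ennreal (4 / x)"
  unfolding local_slope_def
proof (intro SUP_least ennreal_leI)
  fix y :: real assume y: "y \<in> {0..1} - {x}"
  then have pos: "0 < \<bar>x - y\<bar>" by simp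
  have w: "log_wave x = cos (ln x)" "log_wave y = cos (ln y)"
    using x y by (auto simp: log_wave_def)
  have "\<bar>log_wave x - log_wave y\<bar> \<le> 4 / x * \<bar>x - y\<bar>"
  proof (cases "y < x / 2")
    case True
    have "\<bar>cos (ln x) - cos (ln y)\<bar> \<le> 2"
      using abs_cos_le_one[of "ln x"] abs_cos_le_one[of "ln y"] by linarith
    also have "2 \<le> 4 / x * \<bar>x - y\<bar>"
      using True x by (simp add: field_simps)
    finally show ?thesis
      by (simp add: w)
  next
    case False
    have y0: "0 < y"
      using False x by simp
    have "ln (x / y) \<le> x / y - 1" "ln (y / x) \<le> y / x - 1"
      using x y0 by (auto intro!: ln_le_minus_one)
    then have "ln x - ln y \<le> (x - y) / y" "ln y - ln x \<le> (y - x) / x"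
      using x y0 by (auto simp: ln_div diff_divide_distrib)
    moreover have "(x - y) / y \<le> 4 / x * \<bar>x - y\<bar>"
    proof -
      have "(x - y) / y \<le> \<bar>x - y\<bar> / y"
        using y0 by (intro divide_right_mono) auto
      also have "\<dots> \<le> \<bar>x - y\<bar> / (x / 4)"
        using x y0 False by (intro divide_left_mono) auto
      finally show ?thesis by (simp add: mult.commute)
    qed
    moreover have "(y - x) / x \<le> 4 / x * \<bar>x - y\<bar>"
    proof -
      have "(y - x) / x \<le> \<bar>x - y\<bar> / x"
        using x by (intro divide_right_mono) auto
      also have "\<dots> \<le> \<bar>x - y\<bar> / (x / 4)"
        using x by (intro divide_left_mono) auto
      finally show ?thesis by (simp add: mult.commute)
    qed
    ultimately have "\<bar>ln x - ln y\<bar> \<le> 4 / x * \<bar>x - y\<bar>"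
      by linarith
    then show ?thesis
      using abs_cos_diff_le[of "ln x" "ln y"] by (simp add: w)
  qed
  then show "\<bar>log_wave x - log_wave y\<bar> / \<bar>x - y\<bar> \<le> 4 / x"
    using pos by (simp add: pos_divide_le_eq)
qed

lemma weak_smoothness_log_wave: "weak_smoothness log_wave \<le> 4"
  unfolding weak_smoothness_def
proof (rule SUP_least)
  fix t :: real assume "t \<in> {0<..}"
  then have t: "t > 0" by simp
  let ?E = "{x \<in> {0..1}. local_slope log_wave x \<ge> ennreal t}"
  have "x \<le> 4 / t" if "x \<in> ?E" for x
  proof (cases "x = 0")
    case False
    have "ennreal t \<le> ennreal (4 / x)"
      using that False by (intro order_trans[OF _ local_slope_log_wave]) auto
    then show ?thesis
      using t that False by (auto simp: ennreal_le_iff field_simps)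
  qed (use t in simp)
  then have "?E \<subseteq> {0..4 / t}"
    by auto
  then have "emeasure lebesgue ?E \<le> emeasure lebesgue {0..4 / t}"
    by (rule emeasure_mono) simp
  moreover have "emeasure uniform01 ?E = emeasure lebesgue ?E"
    by (rule emeasure_restrict_space) auto
  ultimately have "emeasure uniform01 ?E \<le> ennreal (4 / t)"
    using t by simp
  then have "ennreal t * emeasure uniform01 ?E \<le> ennreal t * ennreal (4 / t)"
    by (rule mult_left_mono) simp
  also have "\<dots> = 4"
    using t by (simp flip: ennreal_mult)
  finally show "ennreal t * emeasure uniform01 ?E \<le> 4" .
qed

lemma variation_log_wave: "variation log_wave = \<infinity>"
proof (rule ccontr)
  assume "variation log_wave \<noteq> \<infinity>"
  then obtain B where B: "0 \<le> B" "variation log_wave = ennreal B"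
    by (cases "variation log_wave") auto
  obtain n :: nat where n: "B + 2 < real n"
    using reals_Archimedean2 by blast
  \<comment> \<open>The points \<open>exp (- k * pi)\<close>, in increasing order, are the extrema of the wave;
    the partition inserts 0 before them.\<close>
  define p where "p i = (if i = 0 then 0 else exp (- (real (n - i) * pi)))" for i
  have val: "log_wave (p i) = (- 1) ^ (n - i)" if "i \<in> {1..n}" for i
  proof -
    have "log_wave (p i) = cos (real (n - i) * pi)"
      using that by (simp add: log_wave_def p_def del: of_nat_diff)
    then show ?thesis
      by (simp only: cos_npi)
  qed
  have inc: "\<forall>i\<in>{1..n}. p (i - 1) < p i"
    by (auto simp: p_def)
  \<comment> \<open>Every gap contributes 2 except possibly the first one, which starts at 0.\<close>
  have "2 * (real n - 1) \<le> (\<Sum>i = 2..n. 2)"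
    by simp
  also have "\<dots> = (\<Sum>i = 2..n. \<bar>log_wave (p i) - log_wave (p (i - 1))\<bar>)"
  proof (rule sum.cong[OF refl])
    fix i assume i: "i \<in> {2..n}"
    then have "n - (i - 1) = Suc (n - i)" "i \<in> {1..n}" "i - 1 \<in> {1..n}"
      by auto
    then have "log_wave (p i) = (- 1) ^ (n - i)" "log_wave (p (i - 1)) = - ((- 1) ^ (n - i))"
      using val[of i] val[of "i - 1"] by simp_all
    then show "2 = \<bar>log_wave (p i) - log_wave (p (i - 1))\<bar>"
      by (cases "even (n - i)") simp_all
  qed
  also have "\<dots> \<le> (\<Sum>i = 1..n. \<bar>log_wave (p i) - log_wave (p (i - 1))\<bar>)"
    by (rule sum_mono2) auto
  also have "\<dots> \<le> B"
  proof -
    have "ennreal (\<Sum>i = 1..n. \<bar>log_wave (p i) - log_wave (p (i - 1))\<bar>) \<le> variation log_wave"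
      by (rule partition_sum_le_variation[OF _ inc]) (auto simp: p_def)
    then show ?thesis
      using B by (simp add: ennreal_le_iff)
  qed
  finally show False
    using n B by simp
qed

section \<open>The strict inclusions\<close>

theorem theorem1p1:
  shows "Lip_strong \<subset> BV \<and> BV \<subset> Lip_weak"
proof (intro conjI psubsetI)
  show "Lip_strong \<subseteq> BV"
    using variation_le_strong_smoothness by (auto simp: Lip_strong_def BV_def intro: le_less_trans)
  have "spike \<in> BV"
    using variation_spike by (auto simp: BV_def spike_def intro: le_less_trans)
  moreover have "spike \<notin> Lip_strong"
    by (simp add: Lip_strong_def strong_smoothness_spike)
  ultimately show "Lip_strong \<noteq> BV"
    by blast
  show "BV \<subseteq> Lip_weak"
  proof
    fix f assume "f \<in> BV"
    then have f: "f \<in> {0..1} \<rightarrow>\<^sub>E UNIV" "variation f < \<infinity>"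
      by (auto simp: BV_def)
    have "10 * variation f < \<infinity>"
      using f(2) by (simp add: ennreal_mult_less_top)
    then show "f \<in> Lip_weak"
      using f(1) weak_smoothness_le_variation[OF f(2)] by (auto simp: Lip_weak_def)
  qed
  have "log_wave \<in> Lip_weak"
    using weak_smoothness_log_wave by (auto simp: Lip_weak_def log_wave_def intro: le_less_trans)
  moreover have "log_wave \<notin> BV"
    by (simp add: BV_def variation_log_wave)
  ultimately show "BV \<noteq> Lip_weak"
    by blast
qed

end
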